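(* Let $n$ be a positive integer and let $G$ be a finite connected simple graph with vertex set $V$ such that every map-automorphism group of $G$ is cyclic in one of the following two senses (the same alternative for all maps): (a) $|V|=n$ and each $\Gamma_M(G)$ is cyclic of some order $d\mid n$, generated by a permutation of $V$ all of whose cycles have length $d$, so that its cycle index is $\frac1d\sum_{k\mid d}\phi(k)s_k^{n/k}$; or (b) $|V|=n+1$ and each $\Gamma_M(G)$ is cyclic of some order $d\mid n$, generated by a permutation fixing one vertex and having all other cycles of length $d$, so that its cycle index is $\frac1d\sum_{k\mid d}\phi(k)s_1s_k^{n/k}$. Then the imbedding sum of $G$ decomposes uniquely as a sum of these cyclic cycle indexes: if $Z(G)=\sum_{d\mid n}c_d\,\frac1d\sum_{k\mid d}\phi(k)s_k^{n/k}$ (resp. with $s_1s_k^{n/k}$) then the coefficients $c_d$ are uniquely determined. Moreover, writing $Z(G)=\sum_{d\mid n}f(n,d)\,s_d^{n/d}$ (resp. $\sum_{d\mid n}f(n,d)\,s_1s_d^{n/d}$), the number $i_d$ of unlabeled imbeddings of $G$ whose map-automorphism group is cyclic of order $d$ satisfies \[ i_d=d\sum_{k:\ d\mid k,\ k\mid n}\frac{f(n,k)}{\phi(k)}\,\mu(k/d), \] where $\phi$ is Euler's function and $\mu$ is the Möbius function.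
   Context: For a vertex $v$, $N(v)$ is its neighborhood. A rotation at $v$ is a cyclic permutation of $N(v)$ (a single cycle through all of $N(v)$); a rotation system $\rho=\{\rho_v\}_{v\in V}$ together with $G$ is a map $M=(G,\rho)$. The automorphism group $\Gamma=\Gamma(G)$ acts on maps by $\rho\mapsto\rho'$ with $\rho'_{\gamma(v)}=\gamma\rho_v\gamma^{-1}$; the stabilizer of $M$ is the map-automorphism group $\Gamma_M(G)$, and $\Gamma$-orbits of maps are unlabeled imbeddings. $F(\gamma)$ is the set of maps fixed by $\gamma$; $s(\gamma)=\prod_k s_k^{j_k}$ with $j_k$ the number of $k$-cycles of $\gamma$ on $V$; the imbedding sum is $Z(G)=\frac1{|\Gamma|}\sum_{\gamma\in\Gamma}|F(\gamma)|s(\gamma)$; the cycle index of a permutation group $H$ on $V$ is $Z(H)=\frac1{|H|}\sum_{h\in H}s(h)$. *)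

theory Defs
  imports
    "Graph_Theory.Pair_Digraph"
    "Graph_Theory.Digraph_Component"
    "HOL-Algebra.Group_Action"
    "HOL-Algebra.Generated_Groups"
    "HOL-Combinatorics.Orbits"
    "HOL-Library.Poly_Mapping"
    "HOL-Computational_Algebra.Squarefree"
    "HOL-Number_Theory.Totient"
begin

text \<open>
  Finite simple graphs are the \<open>pair_graph\<close>s of Graph_Theory: an edge \<open>{u, v}\<close> is
  the pair of arcs \<open>(u, v)\<close>, \<open>(v, u)\<close>. Both HOL-Algebra and HOL-Combinatorics define
  a constant \<open>orbit\<close>, hence the qualified names below. As HOL-Algebra reserves the
  token \<open>inv\<close>, the inverse of a permutation is written \<open>inv_into UNIV\<close>.
\<close>

definition nbhd :: "'a pair_pre_digraph \<Rightarrow> 'a \<Rightarrow> 'a set" where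
  "nbhd G v = {w. (v, w) \<in> parcs G}"

text \<open>
  \<open>cyclic_on\<close> is false on the empty set; the extra disjunct gives the one-vertex graph
  its unique (empty) rotation.
\<close>

definition rotation_on :: "'a set \<Rightarrow> ('a \<Rightarrow> 'a) \<Rightarrow> bool" where
  "rotation_on S p \<longleftrightarrow> p permutes S \<and> (S = {} \<or> cyclic_on p S)"

text \<open>
  A map on \<open>G\<close> is identified with its rotation system. The value \<open>id\<close> outside the vertex
  set makes equality of functions coincide with equality of rotation systems.
\<close>

definition graph_maps :: "'a pair_pre_digraph \<Rightarrow> ('a \<Rightarrow> 'a \<Rightarrow> 'a) set" where
  "graph_maps G = {\<rho>. (\<forall>v \<in> pverts G. rotation_on (nbhd G v) (\<rho> v)) \<and>
                      (\<forall>v. v \<notin> pverts G \<longrightarrow> \<rho> v = id)}"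

definition aut_group :: "'a pair_pre_digraph \<Rightarrow> ('a \<Rightarrow> 'a) monoid" where
  "aut_group G = \<lparr> carrier = {\<gamma>. \<gamma> permutes pverts G \<and>
       (\<forall>u v. (\<gamma> u, \<gamma> v) \<in> parcs G \<longleftrightarrow> (u, v) \<in> parcs G)}, mult = (\<circ>), one = id \<rparr>"

text \<open>
  The rule \<open>\<rho>' (\<gamma> v) = \<gamma> \<circ> \<rho> v \<circ> \<gamma>\<inverse>\<close>, solved for \<open>\<rho>'\<close>; it is restricted to
  \<open>graph_maps G\<close> because \<open>group_action\<close> expects extensional bijections.
\<close>

definition map_act :: "'a pair_pre_digraph \<Rightarrow> ('a \<Rightarrow> 'a) \<Rightarrow> ('a \<Rightarrow> 'a \<Rightarrow> 'a) \<Rightarrow> ('a \<Rightarrow> 'a \<Rightarrow> 'a)" where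
  "map_act G \<gamma> = (\<lambda>\<rho> \<in> graph_maps G. \<lambda>v. \<gamma> \<circ> \<rho> (inv_into UNIV \<gamma> v) \<circ> inv_into UNIV \<gamma>)"

definition map_aut :: "'a pair_pre_digraph \<Rightarrow> ('a \<Rightarrow> 'a \<Rightarrow> 'a) \<Rightarrow> ('a \<Rightarrow> 'a) set" where
  "map_aut G \<rho> = stabilizer (aut_group G) (map_act G) \<rho>"

definition unlabeled_imbeddings :: "'a pair_pre_digraph \<Rightarrow> ('a \<Rightarrow> 'a \<Rightarrow> 'a) set set" where
  "unlabeled_imbeddings G = orbits (aut_group G) (graph_maps G) (map_act G)"

definition fixed_maps :: "'a pair_pre_digraph \<Rightarrow> ('a \<Rightarrow> 'a) \<Rightarrow> ('a \<Rightarrow> 'a \<Rightarrow> 'a) set" where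
  "fixed_maps G \<gamma> = invariants (graph_maps G) (map_act G) \<gamma>"

text \<open>
  Polynomials over the rationals in the variables \<open>s\<^sub>0, s\<^sub>1, s\<^sub>2, \<dots>\<close>: finitely supported
  maps from monomials (exponent functions) to coefficients.
\<close>

type_synonym spoly = "(nat \<Rightarrow>\<^sub>0 nat) \<Rightarrow>\<^sub>0 rat"

definition svar :: "nat \<Rightarrow> spoly" where
  "svar k = Poly_Mapping.single (Poly_Mapping.single k 1) 1"

definition sconst :: "rat \<Rightarrow> spoly" where
  "sconst c = Poly_Mapping.single 0 c"

definition num_cycles :: "'a set \<Rightarrow> ('a \<Rightarrow> 'a) \<Rightarrow> nat \<Rightarrow> nat" where
  "num_cycles V p k = card {C. \<exists>v \<in> V. C = Orbits.orbit p v \<and> card C = k}"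

definition cycle_monomial :: "'a set \<Rightarrow> ('a \<Rightarrow> 'a) \<Rightarrow> spoly" where
  "cycle_monomial V p = (\<Prod>k = 1..card V. svar k ^ num_cycles V p k)"

definition cycle_index :: "'a set \<Rightarrow> ('a \<Rightarrow> 'a) set \<Rightarrow> spoly" where
  "cycle_index V H = sconst (1 / of_nat (card H)) * (\<Sum>h \<in> H. cycle_monomial V h)"

definition imbedding_sum :: "'a pair_pre_digraph \<Rightarrow> spoly" where
  "imbedding_sum G = sconst (1 / of_nat (card (carrier (aut_group G)))) *
     (\<Sum>\<gamma> \<in> carrier (aut_group G).
        sconst (of_nat (card (fixed_maps G \<gamma>))) * cycle_monomial (pverts G) \<gamma>)"

definition cyclic_gen_by :: "'a pair_pre_digraph \<Rightarrow> ('a \<Rightarrow> 'a) set \<Rightarrow> ('a \<Rightarrow> 'a) \<Rightarrow> bool" where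
  "cyclic_gen_by G H h \<longleftrightarrow> h \<in> carrier (aut_group G) \<and> H = generate (aut_group G) {h}"

definition all_map_auts_semiregular :: "'a pair_pre_digraph \<Rightarrow> nat \<Rightarrow> bool" where
  "all_map_auts_semiregular G n \<longleftrightarrow>
     (\<forall>\<rho> \<in> graph_maps G. \<exists>d h. d dvd n \<and> card (map_aut G \<rho>) = d \<and>
        cyclic_gen_by G (map_aut G \<rho>) h \<and>
        (\<forall>v \<in> pverts G. card (Orbits.orbit h v) = d))"

definition all_map_auts_one_fixed :: "'a pair_pre_digraph \<Rightarrow> nat \<Rightarrow> bool" where
  "all_map_auts_one_fixed G n \<longleftrightarrow>
     (\<forall>\<rho> \<in> graph_maps G. \<exists>d h. d dvd n \<and> card (map_aut G \<rho>) = d \<and>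
        cyclic_gen_by G (map_aut G \<rho>) h \<and>
        (\<exists>u \<in> pverts G. h u = u \<and> (\<forall>v \<in> pverts G - {u}. card (Orbits.orbit h v) = d)))"

text \<open>
  The two families of cyclic cycle indexes have a common shape: the factor \<open>w\<close> is \<open>1\<close>
  in the first and \<open>s\<^sub>1\<close> in the second.
\<close>

definition cyclic_index :: "spoly \<Rightarrow> nat \<Rightarrow> nat \<Rightarrow> spoly" where
  "cyclic_index w n d = sconst (1 / of_nat d) *
     (\<Sum>k | k dvd d. sconst (of_nat (totient k)) * (w * svar k ^ (n div k)))"

definition num_cyclic_imbeddings :: "'a pair_pre_digraph \<Rightarrow> nat \<Rightarrow> nat" where
  "num_cyclic_imbeddings G d = card {X \<in> unlabeled_imbeddings G.
     \<exists>\<rho> \<in> X. card (map_aut G \<rho>) = d \<and> (\<exists>h. cyclic_gen_by G (map_aut G \<rho>) h)}"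

definition moebius :: "nat \<Rightarrow> int" where
  "moebius m = (if squarefree m then (-1) ^ card (prime_factors m) else 0)"

end

theory Submission
  imports Defs "HOL-Algebra.Multiplicative_Group" "HOL-Combinatorics.Cycles"
begin

text \<open>
  Counting pairs (automorphism, fixed map) in two ways, as in Burnside's lemma, shows that the
  imbedding sum is the sum of the cycle indexes of the map-automorphism groups, one for each
  unlabeled imbedding. If \<open>h\<close> generates such a group of order \<open>d\<close>, then \<open>h\<^sup>j\<close> has only cycles of length
  \<open>d / gcd(j, d)\<close> (besides the possible fixed vertex), so the cycle index is the cyclic one and
  the coefficients satisfy \<open>f(n, k) / \<phi>(k) = \<Sum> i\<^sub>d / d\<close> with \<open>d\<close> ranging over the multiples of \<open>k\<close>
  dividing \<open>n\<close>. Moebius inversion over multiples recovers \<open>i\<^sub>d / d\<close>; the same inversion shows that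
  the coefficients of any decomposition are unique.
\<close>

subsection \<open>Moebius inversion over the multiples of a divisor\<close>

text \<open>A new prime adds exactly one prime factor and preserves squarefreeness in both
  directions, so the sign flips; if \<open>d\<close> is not squarefree, both sides vanish.\<close>

lemma moebius_prime_mult:
  assumes "prime p" "\<not> p dvd d"
  shows "moebius (p * d) = - moebius d"
proof -
  have cop: "coprime p d" using assms by (simp add: prime_imp_coprime)
  have "d \<noteq> 0" using assms by (metis dvd_0_right)
  then have "prime_factors (p * d) = insert p (prime_factors d)"
    using assms by (subst prime_factors_product) (auto simp: prime_prime_factors)
  moreover have "p \<notin> prime_factors d" using assms by auto
  moreover have "squarefree (p * d) \<longleftrightarrow> squarefree d"
    using cop assms by (metis squarefree_mult_coprime squarefree_multD(2) squarefree_prime)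
  ultimately show ?thesis by (simp add: moebius_def)
qed

text \<open>The involution \<open>d \<leftrightarrow> p * d\<close>, for a fixed prime \<open>p\<close> dividing \<open>n\<close>, cancels the squarefree
  divisors in pairs.\<close>

lemma sum_moebius_divisors:
  assumes "n > 0"
  shows "(\<Sum>d | d dvd n. moebius d) = (if n = 1 then 1 else 0)"
proof (cases "n = 1")
  case True
  then have "{d. d dvd n} = {1}" by auto
  then show ?thesis using True by (simp add: moebius_def)
next
  case False
  then obtain p where p: "prime p" "p dvd n" using prime_factor_nat by blast
  define A where "A = {d. d dvd n \<and> squarefree d \<and> \<not> p dvd d}"
  define B where "B = {d. d dvd n \<and> squarefree d \<and> p dvd d}"
  have fin: "finite {d. d dvd n}" using assms by simp
  have fA: "finite A" and fB: "finite B" unfolding A_def B_def using fin by auto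
  have B: "B = (*) p ` A"
  proof safe
    fix d assume "d \<in> B"
    then obtain e where e: "d = p * e" and d: "d dvd n" "squarefree d" unfolding B_def by auto
    have "\<not> p dvd e"
    proof
      assume "p dvd e"
      then have "p\<^sup>2 dvd d" using e by (auto simp: power2_eq_square)
      then have "is_unit p" using d(2) unfolding squarefree_def by blast
      then show False using p(1) by auto
    qed
    moreover have "e dvd n" using d e by (metis dvd_mult_right)
    moreover have "squarefree e" using d e by (metis squarefree_multD(2))
    ultimately show "d \<in> (*) p ` A" using e unfolding A_def by auto
  next
    fix e assume "e \<in> A"
    then have e: "e dvd n" "squarefree e" "\<not> p dvd e" unfolding A_def by auto
    have "coprime p e" using e p by (simp add: prime_imp_coprime)
    then show "p * e \<in> B" unfolding B_def
      using e p by (auto simp: divides_mult squarefree_mult_coprime squarefree_prime)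
  qed
  \<comment> \<open>Divisors outside \<open>A\<close> and \<open>B\<close> are not squarefree and
    contribute 0.\<close>
  have "(\<Sum>d | d dvd n. moebius d) = (\<Sum>d\<in>A \<union> B. moebius d)"
    by (rule sum.mono_neutral_right[OF fin]) (auto simp: A_def B_def moebius_def)
  also have "\<dots> = (\<Sum>d\<in>A. moebius d) + (\<Sum>d\<in>B. moebius d)"
    by (rule sum.union_disjoint[OF fA fB]) (auto simp: A_def B_def)
  also have "(\<Sum>d\<in>B. moebius d) = (\<Sum>d\<in>A. moebius (p * d))"
    unfolding B using p by (subst sum.reindex) (auto simp: inj_on_def)
  also have "\<dots> = - (\<Sum>d\<in>A. moebius d)"
    unfolding sum_negf[symmetric]
    by (rule sum.cong) (auto simp: A_def moebius_prime_mult[OF p(1)])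
  finally show ?thesis using False by simp
qed

text \<open>After exchanging the sums, \<open>a e\<close> is multiplied by the sum of
  \<open>moebius\<close> over all divisors of \<open>e div d\<close>, which vanishes unless
  \<open>e = d\<close>.\<close>

lemma moebius_inversion_multiples:
  fixes a g :: "nat \<Rightarrow> 'b :: comm_ring_1"
  assumes n: "n > 0" and d: "d dvd n"
    and g: "\<And>k. k dvd n \<Longrightarrow> g k = (\<Sum>e | k dvd e \<and> e dvd n. a e)"
  shows "(\<Sum>k | d dvd k \<and> k dvd n. g k * of_int (moebius (k div d))) = a d"
proof -
  have d0: "d > 0" using n d by (auto intro: Nat.gr0I)
  have fin: "finite {k. P k \<and> k dvd n}" for P using n by simp
  have "(\<Sum>k | d dvd k \<and> k dvd n. g k * of_int (moebius (k div d)))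
      = (\<Sum>k | d dvd k \<and> k dvd n. \<Sum>e | k dvd e \<and> e dvd n. a e * of_int (moebius (k div d)))"
    by (rule sum.cong) (auto simp: g sum_distrib_right)
  also have "\<dots> = (\<Sum>e | d dvd e \<and> e dvd n. \<Sum>k | d dvd k \<and> k dvd e.
      a e * of_int (moebius (k div d)))"
  proof -
    have fin': "finite {k. d dvd k \<and> k dvd e}" if "e dvd n" for e
      using that n by (auto intro: finite_subset[OF _ finite_divisors_nat[of e]] Nat.gr0I)
    \<comment> \<open>Both double sums run over the pairs \<open>(k, e)\<close> with
      \<open>d dvd k\<close>, \<open>k dvd e\<close> and \<open>e dvd n\<close>; the bijection swaps
      the components.\<close>
    show ?thesis
      by (subst (1 2) sum.Sigma)
         (auto simp: fin fin' intro!: sum.reindex_bij_witness[where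
            i = "\<lambda>(x, y). (y, x)" and j = "\<lambda>(x, y). (y, x)"] intro: dvd_trans)
  qed
  also have "\<dots> = (\<Sum>e | d dvd e \<and> e dvd n. a e * (if e = d then 1 else 0))"
  proof (rule sum.cong)
    fix e assume "e \<in> {e. d dvd e \<and> e dvd n}"
    then obtain m where m: "e = d * m" and e: "e dvd n" by auto
    have m0: "m > 0" using m e n by (auto intro: Nat.gr0I)
    have "(\<Sum>k | d dvd k \<and> k dvd e. moebius (k div d)) = (\<Sum>j | j dvd m. moebius j)"
      by (rule sum.reindex_bij_witness[where i = "(*) d" and j = "\<lambda>k. k div d"])
         (use d0 m in auto)
    also have "\<dots> = (if e = d then 1 else 0)"
      using sum_moebius_divisors[OF m0] m d0 by simp
    finally show "(\<Sum>k | d dvd k \<and> k dvd e. a e * of_int (moebius (k div d)))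
        = a e * (if e = d then 1 else 0)"
      unfolding sum_distrib_left[symmetric] of_int_sum[symmetric] by simp
  qed simp
  also have "\<dots> = a d" using d n by (simp add: fin if_distrib cong: if_cong)
  finally show ?thesis .
qed

subsection \<open>Cycle types of the powers of a permutation\<close>

text \<open>The hypothesis says that \<open>v\<close> is periodic. Its orbit size is the least
  positive return time \<open>m\<close>, and \<open>(p ^^ j) v\<close> depends only on
  \<open>j mod m\<close>.\<close>

lemma funpow_eq_self_iff_card_orbit_dvd:
  assumes "v \<in> Orbits.orbit p v"
  shows "(p ^^ j) v = v \<longleftrightarrow> card (Orbits.orbit p v) dvd j"
proof -
  define m where "m = funpow_dist1 p v v"
  have m: "card (Orbits.orbit p v) = m"
    unfolding m_def orbit_conv_funpow_dist1[OF assms]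
    using card_image[OF inj_on_funpow_dist1[OF assms]] by simp
  have m0: "m > 0" unfolding m_def by simp
  have pm: "(p ^^ m) v = v" using funpow_dist1_prop[OF assms] unfolding m_def .
  have "(p ^^ j) v = (p ^^ (j mod m)) v" using funpow_mod_eq[OF pm] by simp
  moreover have "(p ^^ (j mod m)) v = v \<longleftrightarrow> j mod m = 0"
    using funpow_dist1_least[of "j mod m" p v v] mod_less_divisor[OF m0, of j]
    unfolding m_def[symmetric] by (cases "j mod m = 0") auto
  ultimately show ?thesis using m by (auto simp: dvd_eq_mod_eq_0)
qed

text \<open>The two sides have the same multiples \<open>i\<close>: \<open>p ^^ (j * i)\<close>
  fixes \<open>v\<close> iff \<open>d dvd j * i\<close>, and after division by
  \<open>gcd j d\<close> the remaining factor of \<open>j\<close> is coprime to that of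
  \<open>d\<close>.\<close>

lemma card_orbit_funpow:
  assumes "permutation p"
  shows "card (Orbits.orbit (p ^^ j) v)
    = card (Orbits.orbit p v) div gcd j (card (Orbits.orbit p v))"
proof -
  define d where "d = card (Orbits.orbit p v)"
  have v: "v \<in> Orbits.orbit p v" by (rule permutation_self_in_orbit[OF assms])
  have d0: "d > 0" unfolding d_def
    by (simp add: card_gt_0_iff orbit_nonempty finite_orbit[OF v])
  have g0: "gcd j d > 0" using d0 by simp
  have "((p ^^ j) ^^ d) v = v"
    using funpow_eq_self_iff_card_orbit_dvd[OF v, of "j * d"] unfolding d_def by (simp add: funpow_mult)
  \<comment> \<open>Periodicity of \<open>v\<close> under \<open>p ^^ j\<close> makes the previous
    lemma applicable to this power.\<close>
  then have "v \<in> Orbits.orbit (p ^^ j) v" unfolding orbit_altdef using d0 by force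
  then have "card (Orbits.orbit (p ^^ j) v) dvd i \<longleftrightarrow> d div gcd j d dvd i" for i
  proof -
    assume "v \<in> Orbits.orbit (p ^^ j) v"
    then have "card (Orbits.orbit (p ^^ j) v) dvd i \<longleftrightarrow> (p ^^ (j * i)) v = v"
      using funpow_eq_self_iff_card_orbit_dvd[of v "p ^^ j" i] by (simp add: funpow_mult)
    also have "\<dots> \<longleftrightarrow> d dvd j * i"
      unfolding d_def by (rule funpow_eq_self_iff_card_orbit_dvd[OF v])
    also have "\<dots> \<longleftrightarrow> (d div gcd j d) * gcd j d dvd ((j div gcd j d) * i) * gcd j d"
      by (simp add: ac_simps)
    also have "\<dots> \<longleftrightarrow> d div gcd j d dvd (j div gcd j d) * i"
      using g0 by (intro dvd_times_right_cancel_iff) simp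
    also have "\<dots> \<longleftrightarrow> d div gcd j d dvd i"
      using d0 by (intro coprime_dvd_mult_right_iff) (metis coprime_commute div_gcd_coprime not_gr_zero)
    finally show ?thesis .
  qed
  then show ?thesis unfolding d_def[symmetric] by (meson dvd_antisym dvd_refl)
qed

text \<open>Exponents are grouped by \<open>g = gcd j d\<close>; exactly
  \<open>totient (d div g)\<close> of them share a given \<open>g\<close>. This is how Euler's
  function enters the cycle index of a cyclic group.\<close>

lemma sum_div_gcd_eq_sum_totient:
  fixes x :: "nat \<Rightarrow> 'b :: comm_semiring_1"
  assumes "d > 0"
  shows "(\<Sum>j\<in>{0<..d}. x (d div gcd j d)) = (\<Sum>k | k dvd d. of_nat (totient k) * x k)"
proof -
  have "(\<Sum>j\<in>{0<..d}. x (d div gcd j d))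
      = (\<Sum>g | g dvd d. \<Sum>j\<in>{j\<in>{0<..d}. gcd j d = g}. x (d div gcd j d))"
    by (rule sum.group[symmetric]) (use assms in auto)
  also have "\<dots> = (\<Sum>g | g dvd d. of_nat (totient (d div g)) * x (d div g))"
    by (rule sum.cong) (use assms in \<open>auto simp flip: card_gcd_eq_totient\<close>)
  also have "\<dots> = (\<Sum>k | k dvd d. of_nat (totient k) * x k)"
    by (rule sum.reindex_bij_witness[where i = "\<lambda>k. d div k" and j = "\<lambda>k. d div k"])
       (use assms in \<open>auto simp: div_dvd_iff_mult\<close>)
  finally show ?thesis .
qed

text \<open>Grouping the cycles by length gives the defining product; every length lies in
  \<open>{1..card V}\<close>, so no cycle is lost.\<close>

lemma cycle_monomial_eq_prod_orbits:
  assumes "finite V" "p permutes V"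
  shows "cycle_monomial V p = (\<Prod>C\<in>Orbits.orbit p ` V. svar (card C))"
proof -
  have *: "card C \<in> {1..card V}" if "C \<in> Orbits.orbit p ` V" for C
  proof -
    from that obtain v where v: "v \<in> V" "C = Orbits.orbit p v" by auto
    then have "C \<subseteq> V" using permutes_orbit_subset[OF assms(2)] by simp
    moreover have "C \<noteq> {}" using v orbit_nonempty by simp
    ultimately show ?thesis
      using assms(1) by (simp add: Suc_le_eq card_gt_0_iff card_mono finite_subset)
  qed
  have "cycle_monomial V p
      = (\<Prod>k = 1..card V. \<Prod>C\<in>{C \<in> Orbits.orbit p ` V. card C = k}. svar (card C))"
    unfolding cycle_monomial_def
  proof (rule prod.cong[OF refl])
    fix k
    have "{C. \<exists>v\<in>V. C = Orbits.orbit p v \<and> card C = k} = {C \<in> Orbits.orbit p ` V. card C = k}"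
      by auto
    then show "svar k ^ num_cycles V p k
        = (\<Prod>C\<in>{C \<in> Orbits.orbit p ` V. card C = k}. svar (card C))"
      by (simp add: num_cycles_def)
  qed
  also have "\<dots> = (\<Prod>C\<in>Orbits.orbit p ` V. svar (card C))"
    by (rule prod.group) (use assms(1) * in auto)
  finally show ?thesis .
qed

text \<open>The orbits partition \<open>W\<close> into blocks of size \<open>m\<close>. An empty
  \<open>W\<close> is allowed, as arises from a single fixed vertex.\<close>

lemma prod_orbits_semiregular:
  assumes "finite W" "p permutes W" "\<And>v. v \<in> W \<Longrightarrow> card (Orbits.orbit p v) = m" "m > 0"
  shows "(\<Prod>C\<in>Orbits.orbit p ` W. svar (card C)) = svar m ^ (card W div m)"
proof -
  have perm: "permutation p" using assms permutation_permutes by blast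
  have un: "\<Union> (Orbits.orbit p ` W) = W"
    using permutes_orbit_subset[OF assms(2)] permutation_self_in_orbit[OF perm] by blast
  have "m * card (Orbits.orbit p ` W) = card (\<Union> (Orbits.orbit p ` W))"
  proof (rule card_partition)
    fix c1 c2 assume c: "c1 \<in> Orbits.orbit p ` W" "c2 \<in> Orbits.orbit p ` W" "c1 \<noteq> c2"
    have "cyclic_on p c1" "cyclic_on p c2" using c cyclic_on_orbit'[OF perm] by auto
    then show "c1 \<inter> c2 = {}" using c(3) by (metis disjoint_iff orbit_cyclic_eq3)
  qed (use assms un in auto)
  then have "card (Orbits.orbit p ` W) = card W div m"
    using assms(4) unfolding un by (metis nonzero_mult_div_cancel_left less_numeral_extra(3))
  moreover have "(\<Prod>C\<in>Orbits.orbit p ` W. svar (card C)) = (\<Prod>C\<in>Orbits.orbit p ` W. svar m)"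
    using assms(3) by (intro prod.cong) auto
  ultimately show ?thesis by simp
qed

lemma cycle_monomial_funpow_semiregular:
  assumes "finite V" "h permutes V" "\<And>v. v \<in> V \<Longrightarrow> card (Orbits.orbit h v) = d" "d > 0"
  shows "cycle_monomial V (h ^^ j)
    = svar (d div gcd j d) ^ (card V div (d div gcd j d))"
proof -
  have "permutation h" using assms permutation_permutes by blast
  note co = card_orbit_funpow[OF this, of j]
  have "d div gcd j d > 0" using assms(4) by (simp add: div_greater_zero_iff gcd_le2_nat)
  then show ?thesis
    using cycle_monomial_eq_prod_orbits[OF assms(1) permutes_funpow[OF assms(2)]]
      prod_orbits_semiregular[OF assms(1) permutes_funpow[OF assms(2)]] assms(3) co by simp
qed

text \<open>The fixed vertex \<open>u\<close> contributes \<open>svar 1\<close>, and the power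
  restricts to a permutation of \<open>V - {u}\<close> with cycles of equal length.\<close>

lemma cycle_monomial_funpow_one_fixed:
  assumes "finite V" "h permutes V" "u \<in> V" "h u = u"
    "\<And>v. v \<in> V - {u} \<Longrightarrow> card (Orbits.orbit h v) = d" "d > 0"
  shows "cycle_monomial V (h ^^ j)
    = svar 1 * svar (d div gcd j d) ^ ((card V - 1) div (d div gcd j d))"
proof -
  define q where "q = h ^^ j"
  define W where "W = V - {u}"
  have "permutation h" using assms permutation_permutes by blast
  note co = card_orbit_funpow[OF this, of j, folded q_def]
  have qV: "q permutes V" unfolding q_def by (rule permutes_funpow[OF assms(2)])
  have qu: "q u = u" unfolding q_def using assms(4) by (induction j) auto
  have qW: "q permutes W"
    unfolding W_def using permutes_superset[OF qV, of "V - {u}"] qu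
    by auto
  have W: "finite W" "card W = card V - 1" using assms(1,3) unfolding W_def by auto
  have "d div gcd j d > 0" using assms(6) by (simp add: div_greater_zero_iff gcd_le2_nat)
  then have 1: "(\<Prod>C\<in>Orbits.orbit q ` W. svar (card C)) = svar (d div gcd j d) ^ (card W div (d div gcd j d))"
    by (intro prod_orbits_semiregular[OF W(1) qW]) (use assms(5) co W_def in auto)
  have ou: "Orbits.orbit q u = {u}" using qu by (simp add: orbit_eq_singleton_iff)
  \<comment> \<open>This keeps the factor for \<open>{u}\<close> separate even when the other cycles
    also have length 1.\<close>
  have "Orbits.orbit q u \<notin> Orbits.orbit q ` W"
    using permutes_orbit_subset[OF qW] ou unfolding W_def by blast
  moreover have "Orbits.orbit q ` V = insert (Orbits.orbit q u) (Orbits.orbit q ` W)"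
    using assms(3) unfolding W_def by auto
  ultimately show ?thesis
    using cycle_monomial_eq_prod_orbits[OF assms(1) qV] 1 W ou unfolding q_def by simp
qed

subsection \<open>Polynomials in the cycle variables\<close>

lemma sconst_0: "sconst 0 = 0"
  and sconst_1: "sconst 1 = 1"
  and sconst_add: "sconst (a + b) = sconst a + sconst b"
  and sconst_mult: "sconst (a * b) = sconst a * sconst b"
  and sconst_of_nat: "sconst (of_nat m) = of_nat m"
  by (simp_all add: sconst_def single_add mult_single)

lemma sconst_sum: "sconst (\<Sum>x\<in>A. g x) = (\<Sum>x\<in>A. sconst (g x))"
  by (induction A rule: infinite_finite_induct) (simp_all add: sconst_0 sconst_add)

lemma sconst_inverse_of_nat: "m > 0 \<Longrightarrow> sconst (1 / of_nat m) * of_nat m = 1"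
  by (simp flip: sconst_of_nat sconst_mult add: sconst_1)

lemma svar_power: "svar k ^ m = Poly_Mapping.single (Poly_Mapping.single k m) 1"
  by (induction m) (simp_all add: svar_def mult_single single_add[symmetric])

text \<open>For distinct divisors \<open>d\<close> the monomials differ, since they are powers of
  different variables with nonzero exponent \<open>n div d\<close>, all shifted by the same exponent
  of \<open>w\<close>. The choice of \<open>mon\<close> is independent of \<open>f\<close>, so one
  family reads off the coefficients of every such sum.\<close>

lemma lookup_sum_monomials:
  assumes n: "n > 0" and w: "w = 1 \<or> w = svar 1"
  obtains mon :: "nat \<Rightarrow> nat \<Rightarrow>\<^sub>0 nat" where
    "\<And>f k. k dvd n \<Longrightarrow>
      Poly_Mapping.lookup (\<Sum>d | d dvd n. sconst (f d) * (w * svar d ^ (n div d))) (mon k) = f k"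
proof -
  obtain a where a: "w = Poly_Mapping.single a 1"
    using w by (metis single_one svar_def)
  define mon where "mon k = a + Poly_Mapping.single k (n div k)" for k
  have "sconst c * (w * svar d ^ (n div d)) = Poly_Mapping.single (mon d) c" for c d
    by (simp add: a svar_power sconst_def mult_single mon_def)
  moreover have "Poly_Mapping.lookup (\<Sum>d | d dvd n. Poly_Mapping.single (mon d) (f d)) (mon k) = f k"
    if k: "k dvd n" for f :: "nat \<Rightarrow> rat" and k
  proof -
    have "mon d = mon k \<longleftrightarrow> d = k" if "d dvd n" for d
    proof -
      have "n div d \<noteq> 0" using that n by (simp add: dvd_div_eq_0_iff)
      then show ?thesis unfolding mon_def
        by (metis add_left_cancel lookup_single_eq lookup_single_not_eq)
    qed
    then have "(\<Sum>d | d dvd n. Poly_Mapping.lookup (Poly_Mapping.single (mon d) (f d)) (mon k))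
        = (\<Sum>d | d dvd n. if d = k then f d else 0)"
      by (intro sum.cong) (auto simp: lookup_single when_def)
    also have "\<dots> = f k" using k n by simp
    finally show ?thesis by (simp add: lookup_sum)
  qed
  ultimately show thesis by (intro that[of mon]) simp
qed

text \<open>Exchanging the sums over \<open>k dvd d\<close> and \<open>d dvd n\<close> collects the
  coefficient of each monomial, giving f(n,k) explicitly in terms of \<open>c\<close>.\<close>

lemma sum_cyclic_index:
  assumes n: "n > 0"
  shows "(\<Sum>d | d dvd n. sconst (c d) * cyclic_index w n d)
    = (\<Sum>k | k dvd n. sconst (of_nat (totient k) * (\<Sum>d | k dvd d \<and> d dvd n. c d / of_nat d))
        * (w * svar k ^ (n div k)))"
proof -
  have fin: "finite {k. P k \<and> k dvd n}" "finite {k. k dvd n}" for P using n by auto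
  have fin': "finite {k. k dvd d}" if "d dvd n" for d
    using that n by (auto intro: finite_divisors_nat Nat.gr0I)
  let ?t = "\<lambda>d k. sconst (c d / of_nat d * of_nat (totient k)) * (w * svar k ^ (n div k))"
  have "(\<Sum>d | d dvd n. sconst (c d) * cyclic_index w n d) = (\<Sum>d | d dvd n. \<Sum>k | k dvd d. ?t d k)"
    unfolding cyclic_index_def sum_distrib_left
    by (intro sum.cong refl) (simp flip: sconst_mult mult.assoc)
  also have "\<dots> = (\<Sum>k | k dvd n. \<Sum>d | k dvd d \<and> d dvd n. ?t d k)"
    by (subst (1 2) sum.Sigma)
       (auto simp: fin fin' intro!: sum.reindex_bij_witness[where
          i = "\<lambda>(x, y). (y, x)" and j = "\<lambda>(x, y). (y, x)"] intro: dvd_trans)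
  also have "\<dots> = (\<Sum>k | k dvd n. sconst (of_nat (totient k) *
      (\<Sum>d | k dvd d \<and> d dvd n. c d / of_nat d)) * (w * svar k ^ (n div k)))"
    by (simp add: sum_distrib_left sconst_sum sum_distrib_right mult.commute)
  finally show ?thesis .
qed

text \<open>Comparing coefficients shows that \<open>f k / totient k\<close> is the sum of
  \<open>c d / d\<close> over the multiples \<open>d\<close> of \<open>k\<close> dividing
  \<open>n\<close>, which Moebius inversion solves for \<open>c d / d\<close>.\<close>

lemma cyclic_index_coefficients:
  assumes n: "n > 0" and w: "w = 1 \<or> w = svar 1"
    and eq: "(\<Sum>d | d dvd n. sconst (c d) * cyclic_index w n d)
      = (\<Sum>d | d dvd n. sconst (f d) * (w * svar d ^ (n div d)))"
    and d: "d dvd n"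
  shows "c d = of_nat d * (\<Sum>k | d dvd k \<and> k dvd n.
    f k / of_nat (totient k) * of_int (moebius (k div d)))"
proof -
  obtain mon :: "nat \<Rightarrow> nat \<Rightarrow>\<^sub>0 nat" where mon: "\<And>f k. k dvd n \<Longrightarrow>
      Poly_Mapping.lookup (\<Sum>d | d dvd n. sconst (f d) * (w * svar d ^ (n div d))) (mon k) = f k"
    by (rule lookup_sum_monomials[OF n w]) blast
  have "f k = of_nat (totient k) * (\<Sum>d | k dvd d \<and> d dvd n. c d / of_nat d)"
    if "k dvd n" for k
    using arg_cong[OF eq, of "\<lambda>p. Poly_Mapping.lookup p (mon k)"]
    unfolding sum_cyclic_index[OF n] mon[OF that] by simp
  moreover have "totient k > 0" if "k dvd n" for k
    using that n by (auto intro: Nat.gr0I)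
  ultimately have "(\<Sum>k | d dvd k \<and> k dvd n.
      f k / of_nat (totient k) * of_int (moebius (k div d))) = c d / of_nat d"
    by (intro moebius_inversion_multiples[OF n d]) auto
  moreover have "d > 0" using d n by (auto intro: Nat.gr0I)
  ultimately show ?thesis by simp
qed

text \<open>Both \<open>c\<close> and \<open>c'\<close> are given by the inversion formula applied
  to the monomial expansion of the \<open>c'\<close> sum.\<close>

lemma cyclic_index_decomposition_unique:
  assumes n: "n > 0" and w: "w = 1 \<or> w = svar 1"
    and eq: "(\<Sum>d | d dvd n. sconst (c d) * cyclic_index w n d)
      = (\<Sum>d | d dvd n. sconst (c' d) * cyclic_index w n d)"
    and d: "d dvd n"
  shows "c d = c' d"
  using cyclic_index_coefficients[OF n w eq[unfolded sum_cyclic_index[OF n, of c']] d]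
    cyclic_index_coefficients[OF n w sum_cyclic_index[OF n] d, of c'] by (rule trans[OF _ sym])

subsection \<open>Weighted orbit counting\<close>

context group_action
begin

lemma orbits_representative:
  assumes "X \<in> orbits G E \<phi>"
  obtains x where "x \<in> X" "x \<in> E"
proof -
  from assms obtain x where "x \<in> E" "X = Group_Action.orbit G \<phi> x"
    unfolding orbits_def by blast
  then show thesis using orbit_refl that by blast
qed

text \<open>Orbit-stabilizer in a form that depends only on \<open>X\<close>: the stabilizer order
  is constant on an orbit.\<close>

lemma card_stabilizer_eq:
  assumes "finite (carrier G)" "X \<in> orbits G E \<phi>" "x \<in> X"
  shows "card (stabilizer G \<phi> x) = order G div card X"
proof -
  have x: "x \<in> E" using assms orbits_coverture by blast
  then have "Group_Action.orbit G \<phi> x \<in> orbits G E \<phi>" unfolding orbits_def by blast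
  then have X: "X = Group_Action.orbit G \<phi> x"
    using disjoint_union[OF assms(2)] orbit_refl[OF x] assms(3) by blast
  moreover have "finite (Group_Action.orbit G \<phi> x)" unfolding Group_Action.orbit_def using assms(1) by simp
  ultimately have "card X \<noteq> 0" using assms(3) by auto
  then show ?thesis using orbit_stabilizer_theorem[OF x] X by (metis nonzero_mult_div_cancel_left)
qed

text \<open>Pairs \<open>(g, x)\<close> with \<open>g\<close> fixing \<open>x\<close>, each of
  weight \<open>s g\<close>, are counted in two ways.\<close>

lemma sum_invariants_eq_sum_stabilizers:
  fixes s :: "'a \<Rightarrow> 'd :: semiring_1"
  assumes "finite (carrier G)" "finite E"
  shows "(\<Sum>g\<in>carrier G. of_nat (card (invariants E \<phi> g)) * s g)
    = (\<Sum>x\<in>E. \<Sum>g\<in>stabilizer G \<phi> x. s g)"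
proof -
  have "(\<Sum>g\<in>carrier G. of_nat (card (invariants E \<phi> g)) * s g)
      = (\<Sum>g\<in>carrier G. \<Sum>x\<in>E. if \<phi> g x = x then s g else 0)"
    using assms(2) by (simp add: invariants_def sum.inter_filter[symmetric])
  also have "\<dots> = (\<Sum>x\<in>E. \<Sum>g\<in>carrier G. if \<phi> g x = x then s g else 0)"
    by (rule sum.swap)
  also have "\<dots> = (\<Sum>x\<in>E. \<Sum>g\<in>stabilizer G \<phi> x. s g)"
    using assms(1) by (simp add: stabilizer_def sum.inter_filter[symmetric])
  finally show ?thesis .
qed

text \<open>\<open>Z\<close> plays the role of the average of \<open>s\<close> over a stabilizer. As
  it depends only on the stabilizer order, it is constant on each orbit.\<close>

lemma weighted_burnside:
  fixes s :: "'a \<Rightarrow> 'd :: comm_semiring_1"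
  assumes fin: "finite (carrier G)" "finite E"
    and Z: "\<And>x. x \<in> E \<Longrightarrow> (\<Sum>g\<in>stabilizer G \<phi> x. s g)
      = of_nat (card (stabilizer G \<phi> x)) * Z (card (stabilizer G \<phi> x))"
  shows "(\<Sum>g\<in>carrier G. of_nat (card (invariants E \<phi> g)) * s g)
    = of_nat (order G) * (\<Sum>X\<in>orbits G E \<phi>. Z (order G div card X))"
proof -
  have "(\<Sum>x\<in>X. \<Sum>g\<in>stabilizer G \<phi> x. s g) = of_nat (order G) * Z (order G div card X)"
    if X: "X \<in> orbits G E \<phi>" for X
  proof -
    have "(\<Sum>x\<in>X. \<Sum>g\<in>stabilizer G \<phi> x. s g)
        = (\<Sum>x\<in>X. of_nat (card (stabilizer G \<phi> x)) * Z (order G div card X))"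
    proof (rule sum.cong)
      fix x assume x: "x \<in> X"
      then have "x \<in> E" using orbits_coverture X by blast
      from Z[OF this] show "(\<Sum>g\<in>stabilizer G \<phi> x. s g)
          = of_nat (card (stabilizer G \<phi> x)) * Z (order G div card X)"
        unfolding card_stabilizer_eq[OF fin(1) X x] .
    qed simp
    \<comment> \<open>The stabilizer orders of the points of one orbit add up to the group
      order.\<close>
    also have "\<dots> = of_nat (order G) * Z (order G div card X)"
      unfolding sum_distrib_right[symmetric] of_nat_sum[symmetric] card_stablizer_sum[OF fin(1) X] ..
    finally show ?thesis .
  qed
  then show ?thesis
    unfolding sum_invariants_eq_sum_stabilizers[OF fin] disjoint_sum[OF fin(2), symmetric]
    by (simp add: sum_distrib_left)
qed

end

subsection \<open>The action of the automorphism group on maps\<close>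

lemma group_aut_group: "group (aut_group G)"
proof (rule groupI)
  fix x assume "x \<in> carrier (aut_group G)"
  then have x: "x permutes pverts G" "\<And>u v. (x u, x v) \<in> parcs G \<longleftrightarrow> (u, v) \<in> parcs G"
    by (auto simp: aut_group_def)
  let ?y = "inv_into UNIV x"
  have "(?y u, ?y v) \<in> parcs G \<longleftrightarrow> (u, v) \<in> parcs G" for u v
    using x(2)[of "?y u" "?y v"] permutes_inverses(1)[OF x(1)] by simp
  then show "\<exists>y\<in>carrier (aut_group G). y \<otimes>\<^bsub>aut_group G\<^esub> x = \<one>\<^bsub>aut_group G\<^esub>"
    using permutes_inv[OF x(1)] permutes_inv_o(2)[OF x(1)] by (auto simp: aut_group_def)
qed (auto simp: aut_group_def permutes_compose permutes_id o_assoc)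

lemma aut_group_pow: "h [^]\<^bsub>aut_group G\<^esub> (j :: nat) = h ^^ j"
proof -
  interpret group "aut_group G" by (rule group_aut_group)
  show ?thesis
    by (induction j) (simp_all add: aut_group_def funpow_Suc_right del: funpow.simps(2))
qed

text \<open>Conjugation by \<open>g\<close> relabels the single cycle through \<open>S\<close> as a
  single cycle through the image.\<close>

lemma rotation_on_conjugate:
  fixes g :: "'a \<Rightarrow> 'a"
  assumes "bij g" "rotation_on S p"
  shows "rotation_on (g ` S) (g \<circ> p \<circ> inv_into UNIV g)"
proof -
  have gi: "inv_into UNIV g (g x) = x" "g (inv_into UNIV g x) = x" for x
    using assms(1) by (simp_all add: bij_is_inj bij_is_surj surj_f_inv_f)
  have p: "p permutes S" "S = {} \<or> cyclic_on p S" using assms(2) by (auto simp: rotation_on_def)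
  have "g \<circ> p \<circ> inv_into UNIV g permutes g ` S"
    unfolding permutes_def
  proof (intro conjI allI impI)
    have "bij (g \<circ> p \<circ> inv_into UNIV g)"
      using assms(1) permutes_bij[OF p(1)] by (intro bij_comp bij_imp_bij_inv)
    then show "\<exists>!x. (g \<circ> p \<circ> inv_into UNIV g) x = y" for y by (metis bij_pointE)
    show "(g \<circ> p \<circ> inv_into UNIV g) x = x" if "x \<notin> g ` S" for x
      using that permutes_not_in[OF p(1), of "inv_into UNIV g x"] gi(2)[of x]
      by (metis comp_apply imageI)
  qed
  moreover have "cyclic_on (g \<circ> p \<circ> inv_into UNIV g) (g ` S)" if "cyclic_on p S"
    by (rule cyclic_on_image[OF that]) (simp add: gi)
  ultimately show ?thesis using p(2) by (auto simp: rotation_on_def)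
qed

lemma nbhd_automorphism:
  assumes "g \<in> carrier (aut_group G)"
  shows "nbhd G (g v) = g ` nbhd G v"
proof -
  have "bij g" and e: "\<And>u v. (g u, g v) \<in> parcs G \<longleftrightarrow> (u, v) \<in> parcs G"
    using assms by (auto simp: aut_group_def permutes_bij)
  then have "surj g" by (simp add: bij_is_surj)
  then show ?thesis unfolding nbhd_def using e by (auto simp: image_iff) (metis surjD)
qed

lemma map_act_closed:
  assumes g: "g \<in> carrier (aut_group G)" and r: "\<rho> \<in> graph_maps G"
  shows "map_act G g \<rho> \<in> graph_maps G"
proof -
  have gp: "g permutes pverts G" using g by (simp add: aut_group_def)
  let ?i = "inv_into UNIV g"
  have gi: "g (?i x) = x" for x using permutes_inverses(1)[OF gp] .
  have "rotation_on (nbhd G v) (g \<circ> \<rho> (?i v) \<circ> ?i)" if "v \<in> pverts G" for v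
  proof -
    have "?i v \<in> pverts G" using permutes_in_image[OF permutes_inv[OF gp]] that by blast
    then have "rotation_on (nbhd G (?i v)) (\<rho> (?i v))" using r by (simp add: graph_maps_def)
    from rotation_on_conjugate[OF permutes_bij[OF gp] this] show ?thesis
      by (simp add: nbhd_automorphism[OF g, symmetric] gi)
  qed
  moreover have "g \<circ> \<rho> (?i v) \<circ> ?i = id" if "v \<notin> pverts G" for v
  proof -
    have "?i v \<notin> pverts G" using permutes_in_image[OF permutes_inv[OF gp]] that by blast
    then have "\<rho> (?i v) = id" using r by (simp add: graph_maps_def)
    then show ?thesis using permutes_inv_o(1)[OF gp] by simp
  qed
  ultimately show ?thesis using r by (simp add: map_act_def graph_maps_def)
qed

lemma map_act_comp:
  assumes "g \<in> carrier (aut_group G)" "h \<in> carrier (aut_group G)" "\<rho> \<in> graph_maps G"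
  shows "map_act G (g \<circ> h) \<rho> = map_act G g (map_act G h \<rho>)"
proof -
  have "bij g" "bij h" using assms by (auto simp: aut_group_def permutes_bij)
  then show ?thesis
    using assms map_act_closed[OF assms(2,3)] by (simp add: map_act_def o_inv_distrib comp_assoc)
qed

lemma map_act_id: "map_act G id = (\<lambda>\<rho>\<in>graph_maps G. \<rho>)"
  by (simp add: map_act_def)

text \<open>Bijectivity comes from the action of the inverse automorphism; the extensionality
  demanded by \<open>Bij\<close> comes from the restriction in \<open>map_act\<close>.\<close>

lemma group_action_map_act: "group_action (aut_group G) (graph_maps G) (map_act G)"
proof -
  interpret group "aut_group G" by (rule group_aut_group)
  have bij: "map_act G g \<in> Bij (graph_maps G)" if g: "g \<in> carrier (aut_group G)" for g
  proof -
    let ?h = "inv\<^bsub>aut_group G\<^esub> g"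
    have h: "?h \<in> carrier (aut_group G)" using g by simp
    have "g \<circ> ?h = id" "?h \<circ> g = id"
      using r_inv[OF g] l_inv[OF g] by (simp_all add: aut_group_def)
    then have "bij_betw (map_act G g) (graph_maps G) (graph_maps G)"
      using map_act_comp[OF g h] map_act_comp[OF h g]
      by (intro bij_betwI[where g = "map_act G ?h"])
         (auto simp: map_act_closed g h map_act_id)
    then show ?thesis by (simp add: Bij_def map_act_def)
  qed
  show ?thesis
    unfolding group_action_def group_hom_def group_hom_axioms_def
  proof (intro conjI group_aut_group group_BijGroup homI)
    fix g h assume gh: "g \<in> carrier (aut_group G)" "h \<in> carrier (aut_group G)"
    have "map_act G (g \<circ> h) = compose (graph_maps G) (map_act G g) (map_act G h)"
      using map_act_comp[OF gh] by (auto simp: compose_def map_act_def fun_eq_iff restrict_def)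
    then show "map_act G (g \<otimes>\<^bsub>aut_group G\<^esub> h)
        = map_act G g \<otimes>\<^bsub>BijGroup (graph_maps G)\<^esub> map_act G h"
      using bij gh by (simp add: BijGroup_def aut_group_def)
  qed (simp add: BijGroup_def bij)
qed

lemma finite_aut_group:
  assumes "finite (pverts G)"
  shows "finite (carrier (aut_group G))"
  by (rule finite_subset[OF _ finite_permutations[OF assms]]) (auto simp: aut_group_def)

text \<open>Neighbors are vertices, so each rotation is one of finitely many permutations of
  \<open>pverts G\<close>; outside the vertices the value is fixed.\<close>

lemma finite_graph_maps:
  assumes "pair_fin_digraph G"
  shows "finite (graph_maps G)"
proof -
  interpret pair_fin_digraph G by fact
  have "p permutes pverts G" if "rotation_on (nbhd G v) p" for v p
    using that in_arcsD2 by (auto simp: rotation_on_def nbhd_def intro: permutes_subset)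
  then have "graph_maps G \<subseteq> {\<rho>. \<forall>v. (v \<in> pverts G \<longrightarrow> \<rho> v \<in> {p. p permutes pverts G}) \<and>
      (v \<notin> pverts G \<longrightarrow> \<rho> v = id)}"
    by (auto simp: graph_maps_def)
  then show ?thesis
    by (rule finite_subset)
       (rule finite_set_of_finite_funs[OF pair_finite_verts finite_permutations[OF pair_finite_verts]])
qed

section \<open>Cycle indexes of cyclic map-automorphism groups\<close>

lemma sum_generate_aut_group:
  fixes s :: "('a \<Rightarrow> 'a) \<Rightarrow> 'b :: comm_monoid_add"
  assumes "finite (pverts G)" "h \<in> carrier (aut_group G)" "card (generate (aut_group G) {h}) = d"
  shows "(\<Sum>g\<in>generate (aut_group G) {h}. s g) = (\<Sum>j\<in>{0<..d}. s (h ^^ j))"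
proof -
  interpret group "aut_group G" by (rule group_aut_group)
  note gen = generate_pow_on_finite_carrier[OF finite_aut_group[OF assms(1)] assms(2)]
  have inj: "inj_on (\<lambda>j. h ^^ j) {0<..d}"
    using ord_inj'[OF assms(2)] generate_pow_card[OF assms(2)] assms(3)
    by (simp add: aut_group_pow atLeastSucAtMost_greaterThanAtMost)
  have "d > 0"
    using ord_ge_1[OF finite_aut_group[OF assms(1)] assms(2)] generate_pow_card[OF assms(2)] assms(3)
    by simp
  then have "finite (generate (aut_group G) {h})" using assms(3) card_gt_0_iff by blast
  \<comment> \<open>The \<open>d\<close> distinct powers fill a group of order \<open>d\<close>; the
    identity appears as \<open>h ^^ d\<close>, matching the range of the totient sum.\<close>
  then have "(\<lambda>j. h ^^ j) ` {0<..d} = generate (aut_group G) {h}"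
    by (rule card_subset_eq) (use gen card_image[OF inj] assms(3) in \<open>auto simp: aut_group_pow\<close>)
  then show ?thesis using sum.reindex[OF inj, of s] by simp
qed

lemma sum_cycle_monomials_generate:
  assumes "finite (pverts G)" "h \<in> carrier (aut_group G)" "card (generate (aut_group G) {h}) = d"
    and "d > 0"
    and "\<And>j. cycle_monomial (pverts G) (h ^^ j)
      = w * svar (d div gcd j d) ^ (n div (d div gcd j d))"
  shows "(\<Sum>g\<in>generate (aut_group G) {h}. cycle_monomial (pverts G) g)
    = of_nat d * cyclic_index w n d"
proof -
  have "(\<Sum>g\<in>generate (aut_group G) {h}. cycle_monomial (pverts G) g)
      = (\<Sum>k | k dvd d. of_nat (totient k) * (w * svar k ^ (n div k)))"
    unfolding sum_generate_aut_group[OF assms(1-3)] assms(5)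
    by (rule sum_div_gcd_eq_sum_totient[OF assms(4)])
  \<comment> \<open>The factor 1 is written as \<open>d * (1 / d)\<close> to expose the
    normalization in \<open>cyclic_index\<close>.\<close>
  also have "\<dots> = (of_nat d * sconst (1 / of_nat d)) * \<dots>"
    using sconst_inverse_of_nat[OF assms(4)] by (simp add: mult.commute)
  finally show ?thesis by (simp add: cyclic_index_def sconst_of_nat mult.assoc)
qed

text \<open>The two alternatives differ only in the cycle type of the powers of the generator; the
  factor \<open>w\<close> absorbs this difference for all later counting.\<close>

lemma map_aut_cyclic_index:
  assumes n: "n > 0" and fin: "finite (pverts G)"
    and cyc: "(card (pverts G) = n \<and> all_map_auts_semiregular G n \<and> w = 1) \<or>
         (card (pverts G) = n + 1 \<and> all_map_auts_one_fixed G n \<and> w = svar 1)"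
    and r: "\<rho> \<in> graph_maps G"
  shows "card (map_aut G \<rho>) dvd n" "\<exists>h. cyclic_gen_by G (map_aut G \<rho>) h"
    and "(\<Sum>g\<in>map_aut G \<rho>. cycle_monomial (pverts G) g)
      = of_nat (card (map_aut G \<rho>)) * cyclic_index w n (card (map_aut G \<rho>))"
proof -
  obtain d h where d: "d dvd n" "card (map_aut G \<rho>) = d" and h: "cyclic_gen_by G (map_aut G \<rho>) h"
    and type: "(card (pverts G) = n \<and> w = 1 \<and> (\<forall>v\<in>pverts G. card (Orbits.orbit h v) = d)) \<or>
      (card (pverts G) = n + 1 \<and> w = svar 1 \<and>
        (\<exists>u\<in>pverts G. h u = u \<and> (\<forall>v\<in>pverts G - {u}. card (Orbits.orbit h v) = d)))"
    using cyc r unfolding all_map_auts_semiregular_def all_map_auts_one_fixed_def by blast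
  show "card (map_aut G \<rho>) dvd n" "\<exists>h. cyclic_gen_by G (map_aut G \<rho>) h"
    using d h by blast+
  have hc: "h \<in> carrier (aut_group G)" and gen: "map_aut G \<rho> = generate (aut_group G) {h}"
    using h by (auto simp: cyclic_gen_by_def)
  have hp: "h permutes pverts G" using hc by (simp add: aut_group_def)
  have d0: "d > 0" using d(1) n by (auto intro: Nat.gr0I)
  have "cycle_monomial (pverts G) (h ^^ j)
      = w * svar (d div gcd j d) ^ (n div (d div gcd j d))" for j
    using type
  proof (elim disjE conjE bexE)
    assume "card (pverts G) = n" "w = 1" "\<forall>v\<in>pverts G. card (Orbits.orbit h v) = d"
    then show ?thesis
      using cycle_monomial_funpow_semiregular[OF fin hp _ d0, of j] by simp
  next
    fix u assume "card (pverts G) = n + 1" "w = svar 1" "u \<in> pverts G" "h u = u"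
      "\<forall>v\<in>pverts G - {u}. card (Orbits.orbit h v) = d"
    then show ?thesis
      using cycle_monomial_funpow_one_fixed[OF fin hp _ _ _ d0, of u j] by simp
  qed
  then show "(\<Sum>g\<in>map_aut G \<rho>. cycle_monomial (pverts G) g)
      = of_nat (card (map_aut G \<rho>)) * cyclic_index w n (card (map_aut G \<rho>))"
    \<comment> \<open>The order is rewritten to \<open>d\<close> before
      \<open>map_aut G \<rho>\<close> itself is replaced by the generated group.\<close>
    unfolding d(2) unfolding gen
    by (intro sum_cycle_monomials_generate[OF fin hc _ d0]) (use d gen in auto)
qed

section \<open>Counting unlabeled imbeddings by the order of their map-automorphism group\<close>

lemma num_cyclic_imbeddings_eq:
  assumes fin: "finite (pverts G)"
    and cyc: "\<And>\<rho>. \<rho> \<in> graph_maps G \<Longrightarrow> \<exists>h. cyclic_gen_by G (map_aut G \<rho>) h"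
  shows "num_cyclic_imbeddings G d
    = card {X \<in> unlabeled_imbeddings G. order (aut_group G) div card X = d}"
proof -
  interpret group_action "aut_group G" "graph_maps G" "map_act G" by (rule group_action_map_act)
  have "(\<exists>\<rho>\<in>X. card (map_aut G \<rho>) = d \<and> (\<exists>h. cyclic_gen_by G (map_aut G \<rho>) h))
      \<longleftrightarrow> order (aut_group G) div card X = d" if X: "X \<in> unlabeled_imbeddings G" for X
  proof -
    \<comment> \<open>All maps in an orbit have equally large automorphism groups, cyclic by
      \<open>cyc\<close>, so any representative decides membership.\<close>
    have c: "card (map_aut G \<rho>) = order (aut_group G) div card X" if "\<rho> \<in> X" for \<rho>
      using card_stabilizer_eq[OF finite_aut_group[OF fin]] X that
      by (simp add: map_aut_def unlabeled_imbeddings_def)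
    obtain \<rho> where r: "\<rho> \<in> X" "\<rho> \<in> graph_maps G"
      using X orbits_representative unfolding unlabeled_imbeddings_def by blast
    show ?thesis using c r cyc[OF r(2)] by metis
  qed
  then show ?thesis unfolding num_cyclic_imbeddings_def by (intro arg_cong[of _ _ card]) blast
qed

text \<open>Weighted Burnside with cycle monomials as weights and \<open>cyclic_index w n\<close> as
  \<open>Z\<close> gives one cyclic index per unlabeled imbedding; these are then grouped by
  stabilizer order, a divisor of \<open>n\<close>.\<close>

lemma imbedding_sum_eq:
  assumes n: "n > 0" and G: "pair_fin_digraph G"
    and cyc: "(card (pverts G) = n \<and> all_map_auts_semiregular G n \<and> w = 1) \<or>
         (card (pverts G) = n + 1 \<and> all_map_auts_one_fixed G n \<and> w = svar 1)"
  shows "imbedding_sum G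
    = (\<Sum>d | d dvd n. sconst (of_nat (num_cyclic_imbeddings G d)) * cyclic_index w n d)"
proof -
  interpret pair_fin_digraph G by fact
  interpret group_action "aut_group G" "graph_maps G" "map_act G" by (rule group_action_map_act)
  interpret \<Gamma>: group "aut_group G" by (rule group_aut_group)
  note fin = pair_finite_verts
  note map_auts = map_aut_cyclic_index[OF n fin cyc]
  have finite: "finite (carrier (aut_group G))" "finite (graph_maps G)"
    by (rule finite_aut_group[OF fin], rule finite_graph_maps[OF G])
  let ?D = "\<lambda>X. order (aut_group G) div card X"
  have fin_unl: "finite (unlabeled_imbeddings G)"
    unfolding unlabeled_imbeddings_def orbits_def using finite(2) by simp
  have D: "?D X dvd n" if X: "X \<in> unlabeled_imbeddings G" for X
  proof -
    obtain \<rho> where "\<rho> \<in> X" "\<rho> \<in> graph_maps G"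
      using X orbits_representative unfolding unlabeled_imbeddings_def by blast
    then show ?thesis
      using map_auts(1)[of \<rho>] card_stabilizer_eq[OF finite(1), of X \<rho>] X
      by (simp add: map_aut_def unlabeled_imbeddings_def)
  qed
  have "(\<Sum>\<gamma>\<in>carrier (aut_group G).
        sconst (of_nat (card (fixed_maps G \<gamma>))) * cycle_monomial (pverts G) \<gamma>)
      = of_nat (order (aut_group G)) * (\<Sum>X\<in>unlabeled_imbeddings G. cyclic_index w n (?D X))"
    unfolding sconst_of_nat fixed_maps_def unlabeled_imbeddings_def
    by (rule weighted_burnside[OF finite]) (rule map_auts(3)[unfolded map_aut_def])
  then have "imbedding_sum G = (sconst (1 / of_nat (order (aut_group G))) * of_nat (order (aut_group G)))
      * (\<Sum>X\<in>unlabeled_imbeddings G. cyclic_index w n (?D X))"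
    by (simp add: imbedding_sum_def order_def mult.assoc)
  also have "sconst (1 / of_nat (order (aut_group G))) * of_nat (order (aut_group G)) = 1"
    using \<Gamma>.order_gt_0_iff_finite finite(1) by (intro sconst_inverse_of_nat) simp
  also have "1 * (\<Sum>X\<in>unlabeled_imbeddings G. cyclic_index w n (?D X))
      = (\<Sum>d | d dvd n. \<Sum>X\<in>{X \<in> unlabeled_imbeddings G. ?D X = d}. cyclic_index w n (?D X))"
    unfolding mult_1 by (rule sum.group[symmetric]) (use fin_unl n D in auto)
  also have "\<dots> = (\<Sum>d | d dvd n. sconst (of_nat (num_cyclic_imbeddings G d)) * cyclic_index w n d)"
    by (rule sum.cong) (simp_all add: sconst_of_nat num_cyclic_imbeddings_eq[OF fin map_auts(2)])
  finally show ?thesis .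
qed

theorem theorem11:
  fixes G :: "'a pair_pre_digraph" and n :: nat and w :: spoly
  assumes "n > 0"
    and "pair_graph G"
    and "connected (with_proj G)"
    and "(card (pverts G) = n \<and> all_map_auts_semiregular G n \<and> w = 1) \<or>
         (card (pverts G) = n + 1 \<and> all_map_auts_one_fixed G n \<and> w = svar 1)"
  shows "(\<forall>\<rho> \<in> graph_maps G.
            cycle_index (pverts G) (map_aut G \<rho>) = cyclic_index w n (card (map_aut G \<rho>))) \<and>
         (\<exists>c :: nat \<Rightarrow> nat.
            imbedding_sum G = (\<Sum>d | d dvd n. sconst (of_nat (c d)) * cyclic_index w n d)) \<and>
         (\<forall>c c' :: nat \<Rightarrow> rat.
            imbedding_sum G = (\<Sum>d | d dvd n. sconst (c d) * cyclic_index w n d) \<longrightarrow>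
            imbedding_sum G = (\<Sum>d | d dvd n. sconst (c' d) * cyclic_index w n d) \<longrightarrow>
            (\<forall>d. d dvd n \<longrightarrow> c d = c' d)) \<and>
         (\<exists>f :: nat \<Rightarrow> rat.
            imbedding_sum G = (\<Sum>d | d dvd n. sconst (f d) * (w * svar d ^ (n div d)))) \<and>
         (\<forall>f :: nat \<Rightarrow> rat.
            imbedding_sum G = (\<Sum>d | d dvd n. sconst (f d) * (w * svar d ^ (n div d))) \<longrightarrow>
            (\<forall>d. d dvd n \<longrightarrow>
               of_nat (num_cyclic_imbeddings G d) =
                 of_nat d * (\<Sum>k | d dvd k \<and> k dvd n.
                   f k / of_nat (totient k) * of_int (moebius (k div d)))))"
proof (intro conjI ballI allI impI)
  interpret pair_graph G by fact
  note n = assms(1)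
  have w: "w = 1 \<or> w = svar 1" using assms(4) by blast
  note eq = imbedding_sum_eq[OF n pair_fin_digraph_axioms assms(4)]
  show "\<exists>c :: nat \<Rightarrow> nat.
      imbedding_sum G = (\<Sum>d | d dvd n. sconst (of_nat (c d)) * cyclic_index w n d)"
    using eq by blast
  show "\<exists>f :: nat \<Rightarrow> rat.
      imbedding_sum G = (\<Sum>d | d dvd n. sconst (f d) * (w * svar d ^ (n div d)))"
    \<comment> \<open>Unification takes \<open>f\<close> to be the coefficient displayed by
      \<open>sum_cyclic_index\<close>.\<close>
    unfolding eq sum_cyclic_index[OF n] by (rule exI) (rule refl)
  show "cycle_index (pverts G) (map_aut G \<rho>) = cyclic_index w n (card (map_aut G \<rho>))"
    if r: "\<rho> \<in> graph_maps G" for \<rho>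
  proof -
    note map_aut = map_aut_cyclic_index[OF n pair_finite_verts assms(4) r]
    have "card (map_aut G \<rho>) > 0" using map_aut(1) n by (auto intro: Nat.gr0I)
    then show ?thesis
      unfolding cycle_index_def map_aut(3) mult.assoc[symmetric]
      by (simp add: sconst_inverse_of_nat)
  qed
  show "c d = c' d"
    if "imbedding_sum G = (\<Sum>d | d dvd n. sconst (c d) * cyclic_index w n d)"
      "imbedding_sum G = (\<Sum>d | d dvd n. sconst (c' d) * cyclic_index w n d)" "d dvd n"
    for c c' :: "nat \<Rightarrow> rat" and d
    using cyclic_index_decomposition_unique[OF n w _ that(3)] that(1,2) by simp
  show "of_nat (num_cyclic_imbeddings G d) = of_nat d * (\<Sum>k | d dvd k \<and> k dvd n.
      f k / of_nat (totient k) * of_int (moebius (k div d)))"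
    if "imbedding_sum G = (\<Sum>d | d dvd n. sconst (f d) * (w * svar d ^ (n div d)))" "d dvd n"
    for f :: "nat \<Rightarrow> rat" and d
    \<comment> \<open>By \<open>eq\<close>, the imbedding counts themselves serve as the
      coefficients \<open>c\<close>.\<close>
    using cyclic_index_coefficients[OF n w _ that(2)] eq that(1) by simp
qed

end
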